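(* Let $p$ be a prime number with $p = 4k+1$ for an integer $k$. There exist positive integers $d, u, v$ such that $(du, dv, duv)$ is a solution for $p$ (that is, $\frac{4}{p} = \frac{1}{du} + \frac{1}{dv} + \frac{1}{duv}$ with $du \le dv \le duv$) if and only if there exist an integer $t \ge 0$ and a positive divisor $w$ of $k+1+t$ such that $w \equiv -1 \pmod{3+4t}$. In particular, if $k+1$ has a positive divisor $w$ with $w \equiv 2 \pmod 3$, then there exist positive integers $d,u,v$ such that $(du, dv, duv)$ is a solution for $p$.
   Context: For a positive integer $p$, a solution for $p$ is a triple $(x,y,z)$ of positive integers with $x \le y \le z$ and $\frac{4}{p} = \frac{1}{x} + \frac{1}{y} + \frac{1}{z}$. *)

theory Defs
  imports Complex_Main "HOL-Number_Theory.Cong" "HOL-Computational_Algebra.Primes"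
begin

definition is_solution :: "nat \<Rightarrow> nat \<times> nat \<times> nat \<Rightarrow> bool" where
  "is_solution p = (\<lambda>(x, y, z).
     0 < x \<and> 0 < y \<and> 0 < z \<and> x \<le> y \<and> y \<le> z \<and>
     (4 / of_nat p :: rat) = 1 / of_nat x + 1 / of_nat y + 1 / of_nat z)"

end

(* Clearing denominators turns the equation into 4 d u v = p (u + v + 1).  Comparing sizes, p cannot
   divide d alone, so by symmetry v = m p and the equation becomes u + 1 + m p = 4 d u m.
   Hence m divides u + 1, say u + 1 = m n, and then p + n = 4 d u.  As p = 4 k + 1, this forces
   n = 3 + 4 t with k + 1 + t = d u and u = m n - 1, so w = u.  All steps are reversible. *)
theory Submission imports Defs begin

text \<open>The right-hand side has common denominator \<open>d * u * v\<close> and numerator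
  \<open>u + v + 1\<close>. Of the two order conditions only \<open>u \<le> v\<close> remains, since
  \<open>d * v \<le> d * u * v\<close> follows from \<open>1 \<le> u\<close>.\<close>

lemma is_solution_iff:
  fixes p d u v :: nat
  assumes "0 < p" "0 < d" "0 < u" "0 < v"
  shows "is_solution p (d * u, d * v, d * u * v) \<longleftrightarrow> u \<le> v \<and> 4 * d * u * v = p * (u + v + 1)"
proof -
  have "(4 / of_nat p :: rat) = 1 / of_nat (d * u) + 1 / of_nat (d * v) + 1 / of_nat (d * u * v)
    \<longleftrightarrow> (4 / of_nat p :: rat) = of_nat (u + v + 1) / of_nat (d * u * v)"
    using assms by (simp add: field_simps)
  also have "\<dots> \<longleftrightarrow> of_nat (4 * d * u * v) = (of_nat (p * (u + v + 1)) :: rat)"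
    using assms by (simp add: field_simps)
  also have "\<dots> \<longleftrightarrow> 4 * d * u * v = p * (u + v + 1)"
    by (rule of_nat_eq_iff)
  finally show ?thesis
    using assms by (auto simp: is_solution_def)
qed

text \<open>The cleared equation is symmetric in \<open>u\<close> and \<open>v\<close>, so the
  ordering can be restored by swapping them.\<close>

lemma ex_is_solution_iff:
  fixes p :: nat
  assumes "0 < p"
  shows "(\<exists>d u v :: nat. 0 < d \<and> 0 < u \<and> 0 < v \<and> is_solution p (d * u, d * v, d * u * v)) \<longleftrightarrow>
    (\<exists>d u v :: nat. 0 < d \<and> 0 < u \<and> 0 < v \<and> 4 * d * u * v = p * (u + v + 1))"
proof
  assume "\<exists>d u v. 0 < d \<and> 0 < u \<and> 0 < v \<and> is_solution p (d * u, d * v, d * u * v)"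
  then show "\<exists>d u v. 0 < d \<and> 0 < u \<and> 0 < v \<and> 4 * d * u * v = p * (u + v + 1)"
    using is_solution_iff[OF assms] by blast
next
  assume "\<exists>d u v. 0 < d \<and> 0 < u \<and> 0 < v \<and> 4 * d * u * v = p * (u + v + 1)"
  then obtain d u v where pos: "0 < d" "0 < u" "0 < v" and eq: "4 * d * u * v = p * (u + v + 1)"
    by blast
  have eq': "4 * d * v * u = p * (v + u + 1)"
    using eq by (simp add: ac_simps)
  show "\<exists>d u v. 0 < d \<and> 0 < u \<and> 0 < v \<and> is_solution p (d * u, d * v, d * u * v)"
  proof (cases "u \<le> v")
    case True
    then have "is_solution p (d * u, d * v, d * u * v)"
      unfolding is_solution_iff[OF assms pos] using eq by (rule conjI)
    then show ?thesis
      using pos by blast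
  next
    case False
    then have "v \<le> u"
      by simp
    then have "is_solution p (d * v, d * u, d * v * u)"
      unfolding is_solution_iff[OF assms pos(1,3,2)] using eq' by (rule conjI)
    then show ?thesis
      using pos by blast
  qed
qed

text \<open>An odd prime does not divide 4, so it divides \<open>d\<close>, \<open>u\<close> or
  \<open>v\<close>. If \<open>d = p * e\<close>, cancelling \<open>p\<close> leaves
  \<open>4 * e * u * v = u + v + 1\<close>. This is impossible: each summand on the right is at most
  \<open>u * v\<close>, so the right side is at most three times \<open>u * v\<close>.\<close>

lemma prime_dvd_factor:
  fixes p d u v :: nat
  assumes "prime p" "odd p" "0 < d" "0 < u" "0 < v" and eq: "4 * d * u * v = p * (u + v + 1)"
  shows "p dvd u \<or> p dvd v"
proof (rule ccontr)
  assume "\<not> (p dvd u \<or> p dvd v)"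
  \<comment> \<open>The 4 is split into prime factors so that \<open>prime_dvd_mult_iff\<close>
    reduces everything to \<open>p dvd 2\<close>.\<close>
  moreover have "p dvd 2 * (2 * (d * (u * v)))"
    using eq by (metis dvd_triv_left mult.assoc numeral_Bit0 mult_2)
  moreover have "\<not> p dvd 2"
    using assms(1,2) by (metis primes_dvd_imp_eq two_is_prime_nat)
  ultimately have "p dvd d"
    unfolding prime_dvd_mult_iff[OF assms(1)] by blast
  then obtain e where e: "d = p * e" ..
  have "p * (4 * e * (u * v)) = p * (u + v + 1)"
    using eq e by (simp add: ac_simps)
  then have "4 * e * (u * v) = u + v + 1"
    using prime_gt_0_nat[OF assms(1)] by (simp only: nat_mult_eq_cancel1)
  moreover have "1 \<le> e"
    using assms(3) e by (cases e) auto
  then have "4 * 1 * (u * v) \<le> 4 * e * (u * v)"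
    by (intro mult_le_mono) auto
  moreover have "u \<le> u * v" "v \<le> u * v" "1 \<le> u * v"
    using assms(4,5) by auto
  ultimately show False
    by linarith
qed

text \<open>Stated over the integers because the differences defining \<open>n\<close> and
  \<open>t\<close> are not yet known to be nonnegative.\<close>

lemma divisor_of_reduced_equation:
  fixes p k d u m :: int
  assumes "p = 4 * k + 1" "0 < p" "0 < u" "0 < m" and eq: "4 * d * u * m = u + m * p + 1"
  obtains t where "0 \<le> t" "u dvd k + 1 + t" "[u = -1] (mod (3 + 4 * t))"
proof -
  define n where "n = 4 * d * u - p"
  \<comment> \<open>Chosen so that \<open>k + 1 + t = d * u\<close>, which makes
    \<open>n = 3 + 4 * t\<close> the cofactor of \<open>m\<close> in \<open>u + 1\<close>.\<close>
  define t where "t = d * u - k - 1"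
  have mn: "m * n = u + 1"
    using eq by (simp add: n_def algebra_simps)
  have nt: "n = 3 + 4 * t"
    using assms(1) by (simp add: n_def t_def)
  have "0 < n"
    using mn assms(3,4) by (metis add_pos_pos zero_less_mult_pos zero_less_one)
  \<comment> \<open>A negative integer \<open>t\<close> would give
    \<open>3 + 4 * t \<le> -1\<close>.\<close>
  then have "0 \<le> t"
    using nt by simp
  moreover have "u dvd k + 1 + t"
    by (simp add: t_def)
  moreover have "[u = -1] (mod (3 + 4 * t))"
    using mn nt by (simp add: cong_iff_dvd_diff) (metis dvd_triv_right)
  ultimately show thesis
    by (rule that)
qed

lemma divisor_of_solution:
  fixes p d u v :: nat and k :: int
  assumes "prime p" "int p = 4 * k + 1" "0 < u" "0 < v" "p dvd v"
    and eq: "4 * d * u * v = p * (u + v + 1)"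
  shows "\<exists>t w :: int. 0 \<le> t \<and> 0 < w \<and> w dvd k + 1 + t \<and> [w = -1] (mod (3 + 4 * t))"
proof -
  obtain m where m: "v = p * m"
    using assms(5) ..
  have p: "0 < p"
    using assms(1) prime_gt_0_nat by blast
  have "p * (4 * d * u * m) = p * (u + m * p + 1)"
    using eq m by (simp add: ac_simps)
  then have "4 * d * u * m = u + m * p + 1"
    using p by (simp only: nat_mult_eq_cancel1)
  then have "int (4 * d * u * m) = int (u + m * p + 1)"
    by (rule arg_cong)
  then have "4 * int d * int u * int m = int u + int m * int p + 1"
    by simp
  moreover have "0 < m"
    using assms(4) m by (cases m) auto
  ultimately show ?thesis
    using divisor_of_reduced_equation[OF assms(2), of "int u" "int m" "int d"] p assms(3)
    by (metis of_nat_0_less_iff)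
qed

text \<open>The witnesses are \<open>d = (k + 1 + t) / w\<close>, \<open>u = w\<close> and
  \<open>v = m * p\<close> with \<open>m = (w + 1) / (3 + 4 * t)\<close>.\<close>

lemma solution_of_divisor:
  fixes p :: nat and k t w :: int
  assumes p: "0 < p" "int p = 4 * k + 1"
    and "0 \<le> t" "0 < w" "w dvd k + 1 + t" "[w = -1] (mod (3 + 4 * t))"
  shows "\<exists>d u v :: nat. 0 < d \<and> 0 < u \<and> 0 < v \<and> 4 * d * u * v = p * (u + v + 1)"
proof -
  obtain s where s: "k + 1 + t = w * s"
    using assms(5) ..
  have "3 + 4 * t dvd w + 1"
    using assms(6) by (simp add: cong_iff_dvd_diff)
  then obtain m where m: "w + 1 = (3 + 4 * t) * m" ..
  have "0 < w * s"
    using p assms(3) s by linarith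
  then have s_pos: "0 < s"
    using assms(4) zero_less_mult_pos by blast
  have "0 < (3 + 4 * t) * m"
    using m assms(4) by linarith
  then have m_pos: "0 < m"
    using assms(3) zero_less_mult_pos[of "3 + 4 * t" m] by linarith
  have ps: "int p = 4 * (w * s) - (3 + 4 * t)"
    using p s by linarith
  have "4 * s * w * (m * int p) = int p * (4 * s * w * m)"
    by (simp only: ac_simps)
  \<comment> \<open>Multiplying \<open>4 * w * s = p + (3 + 4 * t)\<close> by \<open>m\<close> turns
    the last summand into \<open>w + 1\<close>.\<close>
  also have "4 * s * w * m = w + m * int p + 1"
    unfolding ps using m by (simp add: algebra_simps)
  finally have "int (4 * nat s * nat w * (nat m * p)) = int (p * (nat w + nat m * p + 1))"
    using s_pos m_pos assms(4) by (simp only: of_nat_mult of_nat_add of_nat_numeral of_nat_1 int_nat_eq less_imp_le if_True)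
  then have "4 * nat s * nat w * (nat m * p) = p * (nat w + nat m * p + 1)"
    by (simp only: of_nat_eq_iff)
  moreover have "0 < nat s" "0 < nat w" "0 < nat m * p"
    using s_pos m_pos assms(4) p(1) by auto
  ultimately show ?thesis
    by blast
qed

theorem mainTheorem3:
  fixes p :: nat and k :: int
  assumes "prime p" and "int p = 4 * k + 1"
  shows "((\<exists>d u v :: nat. 0 < d \<and> 0 < u \<and> 0 < v \<and> is_solution p (d * u, d * v, d * u * v)) \<longleftrightarrow>
          (\<exists>t w :: int. 0 \<le> t \<and> 0 < w \<and> w dvd k + 1 + t \<and> [w = -1] (mod (3 + 4 * t)))) \<and>
         ((\<exists>w :: int. 0 < w \<and> w dvd k + 1 \<and> [w = 2] (mod 3)) \<longrightarrow>
          (\<exists>d u v :: nat. 0 < d \<and> 0 < u \<and> 0 < v \<and> is_solution p (d * u, d * v, d * u * v)))"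
proof -
  have p: "0 < p"
    using assms(1) prime_gt_0_nat by blast
  have "odd (int p)"
    unfolding assms(2) by simp
  then have "odd p"
    by simp
  have iff: "(\<exists>d u v :: nat. 0 < d \<and> 0 < u \<and> 0 < v \<and> is_solution p (d * u, d * v, d * u * v)) \<longleftrightarrow>
          (\<exists>t w :: int. 0 \<le> t \<and> 0 < w \<and> w dvd k + 1 + t \<and> [w = -1] (mod (3 + 4 * t)))"
    (is "?sol \<longleftrightarrow> ?div")
  proof
    assume ?sol
    then obtain d u v where pos: "0 < d" "0 < u" "0 < v"
      and eq: "4 * d * u * v = p * (u + v + 1)"
      unfolding ex_is_solution_iff[OF p] by blast
    have eq': "4 * d * v * u = p * (v + u + 1)"
      using eq by (simp add: ac_simps)
    \<comment> \<open>If \<open>p\<close> divides \<open>v\<close>, the divisor \<open>w\<close> is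
      \<open>u\<close>; if \<open>p\<close> divides \<open>u\<close>, the roles are
      exchanged.\<close>
    from prime_dvd_factor[OF assms(1) \<open>odd p\<close> pos eq] show ?div
      using divisor_of_solution[OF assms pos(2,3) _ eq] divisor_of_solution[OF assms pos(3,2) _ eq']
      by blast
  next
    assume ?div
    then show ?sol
      unfolding ex_is_solution_iff[OF p] using solution_of_divisor[OF p assms(2)] by blast
  qed
  show ?thesis
  proof (rule conjI[OF iff], unfold iff, rule impI)
    assume "\<exists>w :: int. 0 < w \<and> w dvd k + 1 \<and> [w = 2] (mod 3)"
    \<comment> \<open>This is the case \<open>t = 0\<close>, where the modulus is 3 and 2 is
      congruent to -1; the added 0 exposes the value of \<open>t\<close>.\<close>
    then obtain w where w: "0 < w" "w dvd k + 1 + 0" "[w = 2] (mod 3)"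
      by auto
    have "[w = -1] (mod (3 + 4 * 0))"
      using w(3) by (simp add: cong_def)
    then show ?div
      using w(1,2) by blast
  qed
qed

end
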